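(* Let $k\ge 1$ be an integer and let $f(x_1,y_1,z_1,\ldots,x_k,y_k,z_k)$ be a complex-valued function of $3k$ complex variables that is analytic at the origin $(0,0,\ldots,0)\in\mathbb{C}^{3k}$. Then $f$ can be expanded, in a neighborhood of the origin, in an absolutely and uniformly convergent $k$-fold complex Hermite series \[ f(x_1,y_1,z_1,\ldots,x_k,y_k,z_k)=\sum_{m_1,n_1,\ldots,m_k,n_k=0}^\infty \lambda_{m_1,n_1,\ldots,m_k,n_k}\,H_{m_1,n_1}(x_1,y_1,z_1)\cdots H_{m_k,n_k}(x_k,y_k,z_k), \] where the $\lambda_{m_1,n_1,\ldots,m_k,n_k}$ are complex numbers independent of $x_1,y_1,z_1,\ldots,x_k,y_k,z_k$, if and only if, for every $j\in\{1,2,\ldots,k\}$, $f$ satisfies the partial differential equation \[ \frac{\partial f}{\partial z_j}=\frac{\partial^2 f}{\partial x_j\,\partial y_j} \] (in a neighborhood of the origin).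
   Context: For complex numbers $x,y,z$ and non-negative integers $m,n$, the (three-variable) complex Hermite polynomials are defined by \[ H_{m,n}(x,y,z)=\sum_{k=0}^{\min\{m,n\}} k!\binom{m}{k}\binom{n}{k}x^{m-k}y^{n-k}z^k . \] A function is analytic at a point of $\mathbb{C}^N$ if it is holomorphic in a neighborhood of that point. *)

theory Defs
  imports "HOL-Analysis.Analysis"
begin

definition hermite :: "nat \<Rightarrow> nat \<Rightarrow> complex \<Rightarrow> complex \<Rightarrow> complex \<Rightarrow> complex" where
  "hermite m n x y z =
     (\<Sum>k = 0..min m n. fact k * of_nat (m choose k) * of_nat (n choose k)
                        * x ^ (m - k) * y ^ (n - k) * z ^ k)"

text \<open>
  The library's \<open>holomorphic_on\<close> covers one variable only. For several variables: the (real)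
  Frechet derivative exists at every point and is complex linear. Only meant for open \<open>U\<close>.
\<close>

definition sv_holomorphic_on :: "(complex ^ 'n::finite \<Rightarrow> complex) \<Rightarrow> (complex ^ 'n) set \<Rightarrow> bool" where
  "sv_holomorphic_on f U \<longleftrightarrow>
     (\<forall>p\<in>U. \<exists>D. (f has_derivative D) (at p) \<and> (\<forall>c v. D (c *s v) = c * D v))"

definition sv_analytic_at :: "(complex ^ 'n::finite \<Rightarrow> complex) \<Rightarrow> complex ^ 'n \<Rightarrow> bool" where
  "sv_analytic_at f p \<longleftrightarrow> (\<exists>U. open U \<and> p \<in> U \<and> sv_holomorphic_on f U)"

definition cpartial :: "'n::finite \<Rightarrow> (complex ^ 'n \<Rightarrow> complex) \<Rightarrow> complex ^ 'n \<Rightarrow> complex" where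
  "cpartial i f p = deriv (\<lambda>t. f (\<chi> l. if l = i then t else p $ l)) (p $ i)"

text \<open>
  A point of \<open>\<complex>\<^sup>3\<^sup>k\<close> is a vector indexed by \<open>'k \<times> 3\<close> with \<open>k = CARD('k)\<close>:
  the coordinates \<open>(j, 1)\<close>, \<open>(j, 2)\<close>, \<open>(j, 3)\<close> are \<open>x\<^sub>j\<close>, \<open>y\<^sub>j\<close>, \<open>z\<^sub>j\<close>.
\<close>

definition hermite_term ::
    "(('k::finite \<Rightarrow> nat) \<times> ('k \<Rightarrow> nat) \<Rightarrow> complex) \<Rightarrow> ('k \<Rightarrow> nat) \<times> ('k \<Rightarrow> nat)
       \<Rightarrow> complex ^ ('k \<times> 3) \<Rightarrow> complex" where
  "hermite_term c mn p =
     c mn * (\<Prod>j\<in>UNIV. hermite (fst mn j) (snd mn j) (p $ (j, 1)) (p $ (j, 2)) (p $ (j, 3)))"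

text \<open>
  The multiple series is summed without a prescribed order: absolute convergence at each point
  of \<open>U\<close>, and uniform convergence on \<open>U\<close> of the net of finite partial sums.
\<close>

definition hermite_series_on ::
    "(('k::finite \<Rightarrow> nat) \<times> ('k \<Rightarrow> nat) \<Rightarrow> complex) \<Rightarrow> (complex ^ ('k \<times> 3) \<Rightarrow> complex)
       \<Rightarrow> (complex ^ ('k \<times> 3)) set \<Rightarrow> bool" where
  "hermite_series_on c f U \<longleftrightarrow>
     (\<forall>p\<in>U. (\<lambda>mn. norm (hermite_term c mn p)) summable_on UNIV) \<and>
     uniform_limit U (\<lambda>F p. \<Sum>mn\<in>F. hermite_term c mn p) f (finite_subsets_at_top UNIV)"

end

(*
  A separately holomorphic function that is bounded on a polydisc is a power series
  sum a_alpha p^alpha (expand in one variable at a time). The equations say exactly that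
  a_alpha * alpha!  depends only on the exponent sums x_j + z_j and y_j + z_j. Since
  k! C(m,k) C(n,k) = m! n! / ((m-k)! (n-k)! k!), this means that grouping the monomials
  according to (m,n) = (x + z, y + z) turns the power series into a Hermite series: each
  monomial occurs in exactly one Hermite product, so convergence is inherited.
  Conversely, every Hermite product solves the equations and, by Cauchy's inequality,
  uniform convergence passes to the partial derivatives.
*)

theory Submission
  imports Defs "HOL-Complex_Analysis.Complex_Analysis"
begin

subsection \<open>Taylor coefficients depending on a parameter\<close>

text \<open>Expanding in one variable leaves coefficients that depend on the others. The step can be
  repeated only if these coefficients are again separately holomorphic and bounded on the same
  polydisc; Cauchy's inequality gives the bound with the same constant \<open>M\<close>, and a
  uniform limit gives holomorphy. The equations become relations between coefficients by termwise
  differentiation and uniqueness of power series. Each relation trades one unit of the exponent of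
  z_j for one unit each of x_j and y_j, so both exponent sums are kept. A group of monomials with
  given (m,n) is therefore governed by its only member free of all z_j, namely x^m y^n, whose
  coefficient becomes the Hermite coefficient. Every group is finite: a geometric majorant of the
  power series, summed over each group, bounds the Hermite terms and yields absolute and uniform
  convergence at once.\<close>

lemma holomorphic_on_uniform_limit:
  assumes "open U" "\<forall>\<^sub>F n in F. f n holomorphic_on U" "uniform_limit U f g F" "F \<noteq> bot"
  shows "g holomorphic_on U"
  unfolding holomorphic_on_open[OF \<open>open U\<close>]
proof
  fix z assume "z \<in> U"
  then obtain r where r: "r > 0" "cball z r \<subseteq> U"
    using \<open>open U\<close> open_contains_cball by blast
  have "\<forall>\<^sub>F n in F. continuous_on (cball z r) (f n) \<and> f n holomorphic_on ball z r"
    using assms(2) by eventually_elim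
      (meson ball_subset_cball holomorphic_on_imp_continuous_on holomorphic_on_subset order_trans r(2))
  then have "g holomorphic_on ball z r"
    using holomorphic_uniform_limit[OF _ uniform_limit_on_subset[OF assms(3) r(2)] assms(4)] by blast
  then show "\<exists>f'. (g has_field_derivative f') (at z)"
    using r(1) holomorphic_on_open[of "ball z r"] by auto
qed

text \<open>Cauchy's inequality on the circle of radius \<open>s\<close>, kept below
  \<open>r\<close> so that \<open>h\<close> is continuous on the closed disc. The numerator stays
  \<open>M\<close>, so bounds from successive variables combine by adding exponents of
  \<open>s\<close>.\<close>

lemma Taylor_coefficient_bound:
  assumes "0 < s" "s < r" "h holomorphic_on ball 0 r" "\<And>t. t \<in> ball 0 r \<Longrightarrow> norm (h t) \<le> M"
  shows "norm ((deriv ^^ n) h 0 / fact n) \<le> M / s ^ n"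
proof -
  have "norm ((deriv ^^ n) h 0) \<le> fact n * M / s ^ n"
  proof (rule Cauchy_inequality)
    show "h holomorphic_on ball 0 s" using assms by (auto elim: holomorphic_on_subset)
    have "h holomorphic_on cball 0 s" using assms by (auto elim: holomorphic_on_subset)
    then show "continuous_on (cball 0 s) h" by (rule holomorphic_on_imp_continuous_on)
  qed (use assms in auto)
  then show ?thesis by (simp add: norm_divide field_simps)
qed

text \<open>
  Peeling off the lower order terms, the \<open>n\<close>-th Taylor coefficient is the limit, uniform in \<open>w\<close>,
  of \<open>(g t w - (\<Sum>k<n. c k w * t ^ k)) / t ^ n\<close> as \<open>t \<rightarrow> 0\<close>. This needs no joint continuity.
\<close>

lemma holomorphic_Taylor_coefficient:
  fixes g :: "complex \<Rightarrow> complex \<Rightarrow> complex"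
  assumes r: "0 < r"
    and hol_t: "\<And>w. w \<in> ball 0 r \<Longrightarrow> (\<lambda>t. g t w) holomorphic_on ball 0 r"
    and hol_w: "\<And>t. t \<in> ball 0 r \<Longrightarrow> g t holomorphic_on ball 0 r"
    and bd: "\<And>t w. t \<in> ball 0 r \<Longrightarrow> w \<in> ball 0 r \<Longrightarrow> norm (g t w) \<le> M"
  shows "(\<lambda>w. (deriv ^^ n) (\<lambda>t. g t w) 0 / fact n) holomorphic_on ball 0 r"
proof -
  define c where "c n w = (deriv ^^ n) (\<lambda>t. g t w) 0 / fact n" for n w
  define s where "s = r / 2"
  have s: "0 < s" "s < r" using r by (auto simp: s_def)
  have M: "0 \<le> M" using bd[of 0 0] r by (meson centre_in_ball norm_ge_zero order_trans)
  have c_le: "norm (c n w) \<le> M / s ^ n" if "w \<in> ball 0 r" for n w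
    unfolding c_def by (rule Taylor_coefficient_bound) (use that s hol_t bd in auto)
  have sums: "(\<lambda>n. c n w * t ^ n) sums g t w" if "t \<in> ball 0 r" "w \<in> ball 0 r" for t w
    using holomorphic_power_series[OF hol_t[OF that(2)] that(1)] by (simp add: c_def)
  have "c n holomorphic_on ball 0 r" for n
  \<comment> \<open>Strong induction, because the holomorphy of \<open>h t\<close> rests on that of
    all lower coefficients.\<close>
  proof (induction n rule: less_induct)
    case (less n)
    define h where "h t w = (g t w - (\<Sum>k<n. c k w * t ^ k)) / t ^ n" for t w
    \<comment> \<open>For \<open>norm t < s / 2\<close> the tail is dominated by a geometric series
      of ratio 1/2 with first term \<open>M * (norm t / s) ^ Suc n\<close>. Twice this term, divided
      by \<open>norm t ^ n\<close>, is \<open>K * norm t\<close>.\<close>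
    define K where "K = 2 * M / s ^ Suc n"
    have K: "0 \<le> K" using M s by (auto simp: K_def)
    have remainder: "norm (h t w - c n w) \<le> K * norm t"
      if t: "t \<noteq> 0" "norm t < s / 2" and w: "w \<in> ball 0 r" for t w
    proof -
      have "(\<lambda>k. c (k + Suc n) w * t ^ (k + Suc n)) sums (g t w - (\<Sum>k<Suc n. c k w * t ^ k))"
        using sums[of t w] t w s sums_iff_shift[of "\<lambda>k. c k w * t ^ k" "Suc n"] by auto
      moreover have "(\<lambda>k. M / s ^ Suc n * norm t ^ Suc n * (1 / 2) ^ k) sums
                     (M / s ^ Suc n * norm t ^ Suc n * (1 / (1 - 1 / 2)))"
        by (intro sums_mult geometric_sums) auto
      moreover have "norm (c (k + Suc n) w * t ^ (k + Suc n)) \<le> M / s ^ Suc n * norm t ^ Suc n * (1 / 2) ^ k" for k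
      proof -
        have "norm (c (k + Suc n) w * t ^ (k + Suc n)) \<le> M / s ^ (k + Suc n) * norm t ^ (k + Suc n)"
          unfolding norm_mult norm_power by (intro mult_right_mono c_le w) auto
        also have "\<dots> = M / s ^ Suc n * norm t ^ Suc n * (norm t / s) ^ k"
          by (simp add: power_add field_simps)
        also have "\<dots> \<le> M / s ^ Suc n * norm t ^ Suc n * (1 / 2) ^ k"
          using s t M by (intro mult_left_mono power_mono) (auto simp: field_simps)
        finally show ?thesis .
      qed
      ultimately have "norm (g t w - (\<Sum>k<Suc n. c k w * t ^ k)) \<le> M / s ^ Suc n * norm t ^ Suc n * 2"
        using norm_sums_le by fastforce
      moreover have "h t w - c n w = (g t w - (\<Sum>k<Suc n. c k w * t ^ k)) / t ^ n"
        using t by (simp add: h_def field_simps)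
      ultimately have "norm (h t w - c n w) \<le> (M / s ^ Suc n * norm t ^ Suc n * 2) / norm t ^ n"
        by (simp only: norm_divide norm_power) (intro divide_right_mono, auto)
      also have "\<dots> = K * norm t"
        using t(1) by (simp add: K_def field_simps)
      finally show ?thesis .
    qed
    have "uniform_limit (ball 0 r) h (c n) (at 0)"
    proof (rule uniform_limitI)
      fix e :: real assume e: "e > 0"
      define d where "d = min (s / 2) (e / (K + 1))"
      have "d > 0" using e K s by (auto simp: d_def)
      then have "\<forall>\<^sub>F t in at 0. t \<noteq> 0 \<and> dist t 0 < d"
        unfolding eventually_at by (intro exI[of _ d]) auto
      then show "\<forall>\<^sub>F t in at 0. \<forall>w\<in>ball 0 r. dist (h t w) (c n w) < e"
      proof eventually_elim
        case (elim t)
        then have t: "t \<noteq> 0" "norm t < s / 2" "norm t * (K + 1) < e"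
          using K by (auto simp: d_def field_simps)
        moreover have "norm t * (K + 1) = K * norm t + norm t" by (simp add: algebra_simps)
        ultimately have "K * norm t < e" using norm_ge_zero[of t] by linarith
        then show ?case
          using remainder[OF t(1,2)] by (fastforce simp: dist_norm)
      qed
    qed
    moreover have "\<forall>\<^sub>F t in at 0. h t holomorphic_on ball 0 r"
    proof -
      have "\<forall>\<^sub>F t in at (0::complex). t \<noteq> 0 \<and> dist t 0 < r"
        unfolding eventually_at using r by (intro exI[of _ r]) auto
      then show ?thesis
      proof eventually_elim
        case (elim t)
        then have "t \<in> ball 0 r" by simp
        then show ?case unfolding h_def using elim
          by (intro holomorphic_intros hol_w less.IH) auto
      qed
    qed
    ultimately show ?case
      using holomorphic_on_uniform_limit[OF open_ball] by (metis at_neq_bot)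
  qed
  then show ?thesis unfolding c_def .
qed

text \<open>A nonzero coefficient of positive order would make the sum nonzero on a punctured disc.
  Order 0 is settled apart, by evaluation at 0.\<close>

lemma powser_zero_imp_coeff_zero:
  fixes a :: "nat \<Rightarrow> complex"
  assumes r: "0 < r" and sm: "\<And>t. norm t < r \<Longrightarrow> (\<lambda>n. a n * t ^ n) sums 0"
  shows "a n = 0"
proof (cases "n = 0")
  case True
  then show ?thesis using sm[of 0] r by simp
next
  case False
  show ?thesis
  proof (rule ccontr)
    assume "a n \<noteq> 0"
    show False
    proof (rule powser_0_nonzero[where r = r and a = a and \<xi> = 0 and f = "\<lambda>_. 0" and m = n])
      fix s :: real assume "0 < s" and nz: "\<And>z::complex. z \<in> cball 0 s - {0} \<Longrightarrow> (0::complex) \<noteq> 0"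
      then have "of_real s \<in> cball (0::complex) s - {0}" by simp
      then show False using nz by blast
    qed (use r False \<open>a n \<noteq> 0\<close> sm in auto)
  qed
qed

subsection \<open>Polydiscs\<close>

definition upd :: "complex ^ 'n \<Rightarrow> 'n \<Rightarrow> complex \<Rightarrow> complex ^ 'n::finite" where
  "upd p i t = (\<chi> l. if l = i then t else p $ l)"

lemma upd_nth [simp]: "upd p i t $ l = (if l = i then t else p $ l)"
  by (simp add: upd_def)

lemma upd_same [simp]: "upd (upd p i t) i u = upd p i u"
  by (simp add: vec_eq_iff)

lemma upd_triv [simp]: "upd p i (p $ i) = p"
  by (simp add: vec_eq_iff)

lemma upd_commute: "i \<noteq> j \<Longrightarrow> upd (upd p i t) j u = upd (upd p j u) i t"
  by (simp add: vec_eq_iff)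

lemma cpartial_upd: "cpartial i f p = deriv (\<lambda>t. f (upd p i t)) (p $ i)"
  by (simp add: cpartial_def upd_def)

text \<open>Unlike a ball, it is stable under changing one coordinate: each coordinate runs through
  a full disc of radius \<open>r\<close> whatever the others are.\<close>

definition polydisc :: "real \<Rightarrow> (complex ^ 'n::finite) set" where
  "polydisc r = {p. \<forall>i. norm (p $ i) < r}"

lemma upd_in_polydisc [simp]: "p \<in> polydisc r \<Longrightarrow> norm t < r \<Longrightarrow> upd p i t \<in> polydisc r"
  by (simp add: polydisc_def)

lemma polydisc_nth: "p \<in> polydisc r \<Longrightarrow> norm (p $ i) < r"
  by (simp add: polydisc_def)

lemma polydisc_mono: "s \<le> r \<Longrightarrow> p \<in> polydisc s \<Longrightarrow> p \<in> polydisc r"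
  by (auto simp: polydisc_def intro: less_le_trans)

lemma open_polydisc: "open (polydisc r :: (complex ^ 'n::finite) set)"
proof -
  have "polydisc r = (\<Inter>i\<in>UNIV. {p :: complex ^ 'n. norm (p $ i) < r})"
    by (auto simp: polydisc_def)
  also have "open \<dots>"
    by (intro open_INT ballI open_Collect_less continuous_intros) auto
  finally show ?thesis .
qed

lemma polydisc_subset_ball:
  assumes "e > 0"
  obtains r where "r > 0" "polydisc r \<subseteq> ball (0 :: complex ^ 'n::finite) e"
proof
  define r where "r = e / (real CARD('n))"
  show "r > 0" using assms by (simp add: r_def)
  show "polydisc r \<subseteq> ball (0 :: complex ^ 'n) e"
  proof
    fix p :: "complex ^ 'n" assume p: "p \<in> polydisc r"
    have "norm p \<le> (\<Sum>i\<in>UNIV. norm (p $ i))"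
      by (simp add: norm_vec_def L2_set_le_sum)
    also have "\<dots> < (\<Sum>i\<in>(UNIV::'n set). r)"
      by (rule sum_strict_mono) (use p in \<open>auto simp: polydisc_def\<close>)
    also have "\<dots> = e" by (simp add: r_def)
    finally show "p \<in> ball 0 e" by simp
  qed
qed

lemma eventually_nhds_0_polydisc:
  assumes "\<forall>\<^sub>F p in nhds (0 :: complex ^ 'n::finite). P p"
  obtains r where "r > 0" "\<And>p. p \<in> polydisc r \<Longrightarrow> P p"
  using assms unfolding eventually_nhds_metric
  by (metis polydisc_subset_ball mem_ball dist_commute subsetD)

text \<open>Nothing is asked about joint continuity. This is the property that one-variable Taylor
  coefficients inherit, so an induction over the variables can carry it.\<close>

definition separately_holomorphic :: "real \<Rightarrow> (complex ^ 'n::finite \<Rightarrow> complex) \<Rightarrow> bool" where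
  "separately_holomorphic r f \<longleftrightarrow>
     (\<forall>i. \<forall>p\<in>polydisc r. (\<lambda>t. f (upd p i t)) holomorphic_on ball 0 r)"

text \<open>The chain rule along the affine map \<open>upd p i\<close> gives the real derivative
  \<open>D (h *s axis i 1)\<close>; complex linearity of \<open>D\<close> turns it into
  multiplication by a number.\<close>

lemma sv_holomorphic_on_imp_separately_holomorphic:
  fixes f :: "complex ^ 'n::finite \<Rightarrow> complex"
  assumes "sv_holomorphic_on f U" "polydisc r \<subseteq> U"
  shows "separately_holomorphic r f"
  unfolding separately_holomorphic_def holomorphic_on_open[OF open_ball]
proof (intro allI ballI)
  fix i and p :: "complex ^ 'n" and t assume p: "p \<in> polydisc r" and t: "t \<in> ball (0::complex) r"
  then have "upd p i t \<in> U" using assms(2) by auto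
  then obtain D where D: "(f has_derivative D) (at (upd p i t))" "\<And>c v. D (c *s v) = c * D v"
    using assms(1) unfolding sv_holomorphic_on_def by blast
  have bl: "bounded_linear (\<lambda>h. h *s (axis i 1 :: complex ^ 'n))"
    unfolding linear_conv_bounded_linear[symmetric]
    by (rule linearI) (auto simp: vec_eq_iff algebra_simps)
  have upd_eq: "upd p i = (\<lambda>t. upd p i 0 + t *s axis i 1)"
    by (auto simp: fun_eq_iff vec_eq_iff axis_def)
  have "(upd p i has_derivative (\<lambda>h. h *s axis i 1)) (at t)"
    by (subst upd_eq) (auto intro!: derivative_eq_intros bounded_linear_imp_has_derivative bl)
  then have "((\<lambda>t. f (upd p i t)) has_derivative (\<lambda>h. D (h *s axis i 1))) (at t)"
    using has_derivative_compose D(1) by blast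
  then have "((\<lambda>t. f (upd p i t)) has_field_derivative D (axis i 1)) (at t)"
    by (simp add: D(2) has_field_derivative_def mult.commute[of _ "D _"] mult_commute_abs)
  then show "\<exists>f'. ((\<lambda>t. f (upd p i t)) has_field_derivative f') (at t)" ..
qed

subsection \<open>Power series in several variables\<close>

text \<open>Functions on the whole type that vanish off \<open>S\<close>, so that an induction on
  \<open>S\<close> never changes the type of the indices.\<close>

definition multi_indices :: "'n set \<Rightarrow> ('n \<Rightarrow> nat) set" where
  "multi_indices S = {\<alpha>. \<forall>i. i \<notin> S \<longrightarrow> \<alpha> i = 0}"

lemma multi_indices_empty [simp]: "multi_indices {} = {\<lambda>_. 0}"
  unfolding multi_indices_def by blast

lemma multi_indices_UNIV [simp]: "multi_indices UNIV = UNIV"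
  by (simp add: multi_indices_def)

lemma bij_betw_multi_indices_insert:
  assumes "i \<notin> S"
  shows "bij_betw (\<lambda>(\<alpha>, n). \<alpha>(i := n)) (multi_indices S \<times> UNIV) (multi_indices (insert i S))"
  using assms
  by (intro bij_betwI[where g = "\<lambda>\<alpha>. (\<alpha>(i := 0), \<alpha> i)"])
     (auto simp: multi_indices_def fun_eq_iff)

lemma prod_fun_upd:
  assumes "i \<notin> S"
  shows "(\<Prod>j\<in>S. F j ((\<alpha>(i := n)) j)) = (\<Prod>j\<in>S. F j (\<alpha> j))"
  by (rule prod.cong) (use assms in auto)

lemma sum_fun_upd:
  assumes "i \<notin> S"
  shows "(\<Sum>j\<in>S. (\<alpha>(i := n)) j) = (\<Sum>j\<in>S. \<alpha> j)"
  by (rule sum.cong) (use assms in auto)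

text \<open>The terms are nonnegative, so iterated summability suffices for summability over pairs
  and the factors can be summed one at a time. It provides the majorants for power series with
  Cauchy bounds.\<close>

lemma has_sum_multi_geometric:
  fixes q :: "'n \<Rightarrow> real"
  assumes "finite S" "\<And>i. i \<in> S \<Longrightarrow> 0 \<le> q i" "\<And>i. i \<in> S \<Longrightarrow> q i < 1"
  shows "((\<lambda>\<alpha>. \<Prod>i\<in>S. q i ^ \<alpha> i) has_sum (\<Prod>i\<in>S. 1 / (1 - q i))) (multi_indices S)"
  using assms
proof (induction S rule: finite_induct)
  case empty
  then show ?case by (simp add: has_sum_finiteI)
next
  case (insert i S)
  let ?P = "\<lambda>\<alpha>. \<Prod>j\<in>S. q j ^ \<alpha> j"
  have geo: "((\<lambda>n. q i ^ n) has_sum (1 / (1 - q i))) UNIV"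
    using insert.prems by (intro norm_summable_imp_has_sum geometric_sums) (auto simp: power_abs)
  have inner: "((\<lambda>n. ?P \<alpha> * q i ^ n) has_sum (?P \<alpha> * (1 / (1 - q i)))) UNIV" for \<alpha>
    by (intro has_sum_cmult_right geo)
  have outer: "((\<lambda>\<alpha>. ?P \<alpha> * (1 / (1 - q i))) has_sum ((\<Prod>j\<in>S. 1 / (1 - q j)) * (1 / (1 - q i))))
                 (multi_indices S)"
    using insert by (intro has_sum_cmult_left) auto
  have "(\<lambda>(\<alpha>, n). ?P \<alpha> * q i ^ n) summable_on multi_indices S \<times> UNIV"
    by (rule summable_on_SigmaI[where g = "\<lambda>\<alpha>. ?P \<alpha> * (1 / (1 - q i))"])
       (use inner outer insert.prems in \<open>auto simp: summable_on_def intro!: mult_nonneg_nonneg prod_nonneg\<close>)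
  then have "((\<lambda>(\<alpha>, n). ?P \<alpha> * q i ^ n) has_sum ((\<Prod>j\<in>S. 1 / (1 - q j)) * (1 / (1 - q i))))
          (multi_indices S \<times> UNIV)"
    by (intro has_sum_SigmaI[OF _ outer]) (use inner in auto)
  also have "?this \<longleftrightarrow> ((\<lambda>x. (\<lambda>\<alpha>. \<Prod>j\<in>insert i S. q j ^ \<alpha> j) (case x of (\<alpha>, n) \<Rightarrow> \<alpha>(i := n)))
       has_sum ((\<Prod>j\<in>S. 1 / (1 - q j)) * (1 / (1 - q i)))) (multi_indices S \<times> UNIV)"
    using insert.hyps prod_fun_upd[OF insert.hyps(2), of "\<lambda>j. (^) (q j)"]
    by (intro has_sum_cong) (auto simp: mult.commute simp del: fun_upd_apply, simp)
  also have "\<dots> \<longleftrightarrow> ((\<lambda>\<alpha>. \<Prod>j\<in>insert i S. q j ^ \<alpha> j) has_sum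
       ((\<Prod>j\<in>S. 1 / (1 - q j)) * (1 / (1 - q i)))) (multi_indices (insert i S))"
    by (rule has_sum_reindex_bij_betw[OF bij_betw_multi_indices_insert[OF insert.hyps(2)]])
  finally show ?case
    using insert.hyps by (simp add: mult.commute)
qed

text \<open>Splitting off the exponent of variable \<open>i\<close> prepares for Fubini. The
  uniqueness proof uses it to take a series apart, the expansion to assemble one.\<close>

lemma has_sum_multi_indices_insert:
  fixes c :: "('n \<Rightarrow> nat) \<Rightarrow> complex"
  assumes "finite S" "i \<notin> S"
  shows "((\<lambda>\<alpha>. c \<alpha> * (\<Prod>j\<in>insert i S. p j ^ \<alpha> j)) has_sum L) (multi_indices (insert i S)) \<longleftrightarrow>
         ((\<lambda>(\<alpha>, n). c (\<alpha>(i := n)) * p i ^ n * (\<Prod>j\<in>S. p j ^ \<alpha> j)) has_sum L) (multi_indices S \<times> UNIV)"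
proof -
  have "((\<lambda>(\<alpha>, n). c (\<alpha>(i := n)) * p i ^ n * (\<Prod>j\<in>S. p j ^ \<alpha> j)) has_sum L) (multi_indices S \<times> UNIV)
    \<longleftrightarrow> ((\<lambda>x. (\<lambda>\<alpha>. c \<alpha> * (\<Prod>j\<in>insert i S. p j ^ \<alpha> j)) (case x of (\<alpha>, n) \<Rightarrow> \<alpha>(i := n)))
       has_sum L) (multi_indices S \<times> UNIV)"
    using assms prod_fun_upd[OF assms(2), of "\<lambda>j. (^) (p j)"]
    by (intro has_sum_cong) (auto simp del: fun_upd_apply, simp)
  also have "\<dots> \<longleftrightarrow> ((\<lambda>\<alpha>. c \<alpha> * (\<Prod>j\<in>insert i S. p j ^ \<alpha> j)) has_sum L) (multi_indices (insert i S))"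
    by (rule has_sum_reindex_bij_betw[OF bij_betw_multi_indices_insert[OF assms(2)]])
  finally show ?thesis ..
qed

text \<open>With the other coordinates fixed, the sum is a power series in coordinate
  \<open>i\<close>, so each of its coefficients \<open>A n\<close> vanishes. As a function of the
  other coordinates, \<open>A n\<close> is again a vanishing series, with one variable less.\<close>

lemma multi_power_series_unique:
  fixes c :: "('n::finite \<Rightarrow> nat) \<Rightarrow> complex"
  assumes "0 < r"
    and "\<And>p. p \<in> polydisc r \<Longrightarrow> ((\<lambda>\<alpha>. c \<alpha> * (\<Prod>i\<in>S. (p $ i) ^ \<alpha> i)) has_sum 0) (multi_indices S)"
    and "\<alpha> \<in> multi_indices S"
  shows "c \<alpha> = 0"
  using finite[of S] assms(2,3)
proof (induction S arbitrary: c \<alpha> rule: finite_induct)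
  case empty
  have "(0 :: complex ^ 'n) \<in> polydisc r" using assms(1) by (simp add: polydisc_def)
  from empty.prems(1)[OF this] have "((\<lambda>\<alpha>. c \<alpha>) has_sum 0) {\<lambda>_. 0}" by simp
  then have "c (\<lambda>_. 0) = 0"
    by (metis (no_types, lifting) finite.emptyI finite.insertI has_sum_finite has_sum_unique
        sum.empty sum.insert empty_iff add.right_neutral)
  then show ?case using empty.prems(2) by simp
next
  case (insert i S)
  have inner: "((\<lambda>\<beta>. c (\<beta>(i := n)) * (\<Prod>j\<in>S. (p $ j) ^ \<beta> j)) has_sum 0) (multi_indices S)"
    if p: "p \<in> polydisc r" for p n
  proof -
    define A where "A n = (\<Sum>\<^sub>\<infinity>\<beta>\<in>multi_indices S. c (\<beta>(i := n)) * (\<Prod>j\<in>S. (p $ j) ^ \<beta> j))" for n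
    have prod_upd: "(\<Prod>j\<in>S. (upd p i t $ j) ^ \<beta> j) = (\<Prod>j\<in>S. (p $ j) ^ \<beta> j)" for t \<beta>
      by (rule prod.cong) (use insert.hyps in auto)
    have *: "((\<lambda>(n, \<beta>). c (\<beta>(i := n)) * t ^ n * (\<Prod>j\<in>S. (p $ j) ^ \<beta> j)) has_sum 0) (UNIV \<times> multi_indices S)"
      if "norm t < r" for t
    proof -
      have "((\<lambda>(\<beta>, n). c (\<beta>(i := n)) * t ^ n * (\<Prod>j\<in>S. (p $ j) ^ \<beta> j)) has_sum 0) (multi_indices S \<times> UNIV)"
        using insert.prems(1)[of "upd p i t"] p that
        unfolding has_sum_multi_indices_insert[OF insert.hyps] prod_upd by simp
      then have "((\<lambda>x. (\<lambda>(\<beta>, n). c (\<beta>(i := n)) * t ^ n * (\<Prod>j\<in>S. (p $ j) ^ \<beta> j)) (prod.swap x)) has_sum 0)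
             (UNIV \<times> multi_indices S)"
        by (subst has_sum_reindex_bij_betw[where B = "multi_indices S \<times> UNIV"])
           (auto intro!: bij_betwI[where g = prod.swap])
      then show ?thesis by (simp add: case_prod_unfold)
    qed
    have summ: "(\<lambda>\<beta>. c (\<beta>(i := n)) * (\<Prod>j\<in>S. (p $ j) ^ \<beta> j)) summable_on multi_indices S" for n
    proof -
      \<comment> \<open>Any nonzero point of the disc would do: summability is known with the factor
        \<open>t ^ n\<close>, which is then divided out.\<close>
      define t :: complex where "t = of_real (r / 2)"
      have t: "norm t < r" "t \<noteq> 0" using assms(1) by (auto simp: t_def)
      have "(\<lambda>\<beta>. c (\<beta>(i := n)) * t ^ n * (\<Prod>j\<in>S. (p $ j) ^ \<beta> j)) summable_on multi_indices S"
        by (rule summable_on_SigmaD1[of "\<lambda>n \<beta>. c (\<beta>(i := n)) * t ^ n * (\<Prod>j\<in>S. (p $ j) ^ \<beta> j)" UNIV])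
           (use *[OF t(1)] in \<open>auto simp: summable_on_def\<close>)
      then have "(\<lambda>\<beta>. inverse (t ^ n) * (c (\<beta>(i := n)) * t ^ n * (\<Prod>j\<in>S. (p $ j) ^ \<beta> j)))
                   summable_on multi_indices S"
        by (rule summable_on_cmult_right)
      then show ?thesis using t(2) by (simp add: field_simps)
    qed
    then have A: "((\<lambda>\<beta>. c (\<beta>(i := n)) * (\<Prod>j\<in>S. (p $ j) ^ \<beta> j)) has_sum A n) (multi_indices S)" for n
      by (simp add: A_def)
    have "(\<lambda>n. A n * t ^ n) sums 0" if "norm t < r" for t
    proof (rule has_sum_imp_sums, rule has_sum_SigmaD[OF *[OF that]])
      show "((\<lambda>\<beta>. case (n, \<beta>) of (n, \<beta>) \<Rightarrow> c (\<beta>(i := n)) * t ^ n * (\<Prod>j\<in>S. (p $ j) ^ \<beta> j))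
              has_sum A n * t ^ n) (multi_indices S)" for n
        using has_sum_cmult_left[OF A[of n], of "t ^ n"] by (simp add: mult_ac)
    qed
    then have "A n = 0" by (rule powser_zero_imp_coeff_zero[OF assms(1)])
    then show ?thesis using A[of n] by simp
  qed
  have "\<alpha>(i := 0) \<in> multi_indices S"
    using insert.prems(2) by (auto simp: multi_indices_def)
  from insert.IH[OF inner[of _ "\<alpha> i"] this] show ?case
    by (simp only: fun_upd_upd fun_upd_triv)
qed

text \<open>The coefficients remain functions of the full point, from \<open>f\<close> itself for
  empty \<open>S\<close> to functions independent of every coordinate. Bound and holomorphy hold on
  the full polydisc of radius \<open>r\<close> at every stage; only the series is confined to radius
  \<open>s\<close>.\<close>

lemma separately_holomorphic_expansion_aux:
  fixes f :: "complex ^ 'n::finite \<Rightarrow> complex"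
  assumes s: "0 < s" "s < r"
    and hol: "separately_holomorphic r f"
    and bd: "\<And>p. p \<in> polydisc r \<Longrightarrow> norm (f p) \<le> M"
  shows "\<exists>a. (\<forall>\<alpha>. \<forall>p\<in>polydisc r. norm (a \<alpha> p) \<le> M / s ^ (\<Sum>i\<in>S. \<alpha> i))
           \<and> (\<forall>\<alpha>. separately_holomorphic r (a \<alpha>))
           \<and> (\<forall>\<alpha> p t. \<forall>i\<in>S. a \<alpha> (upd p i t) = a \<alpha> p)
           \<and> (\<forall>p\<in>polydisc s. ((\<lambda>\<alpha>. a \<alpha> p * (\<Prod>i\<in>S. (p $ i) ^ \<alpha> i)) has_sum f p) (multi_indices S))"
  using finite[of S]
proof (induction S rule: finite_induct)
  case empty
  show ?case
    by (rule exI[of _ "\<lambda>_. f"]) (use assms in \<open>auto intro!: has_sum_finiteI\<close>)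
next
  case (insert i S)
  then obtain a where a_le: "\<And>\<alpha> p. p \<in> polydisc r \<Longrightarrow> norm (a \<alpha> p) \<le> M / s ^ (\<Sum>i\<in>S. \<alpha> i)"
    and a_hol: "\<And>\<alpha>. separately_holomorphic r (a \<alpha>)"
    and a_indep: "\<And>\<alpha> p t j. j \<in> S \<Longrightarrow> a \<alpha> (upd p j t) = a \<alpha> p"
    and a_sum: "\<And>p. p \<in> polydisc s \<Longrightarrow>
                  ((\<lambda>\<alpha>. a \<alpha> p * (\<Prod>i\<in>S. (p $ i) ^ \<alpha> i)) has_sum f p) (multi_indices S)"
    by blast
  have r: "0 < r" using s by simp
  have a_hol': "(\<lambda>t. a \<alpha> (upd p j t)) holomorphic_on ball 0 r" if "p \<in> polydisc r" for \<alpha> p j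
    using a_hol that by (simp add: separately_holomorphic_def)
  \<comment> \<open>The old coefficient is expanded in coordinate \<open>i\<close> about 0, and
    \<open>\<alpha> i\<close> selects the order; resetting that entry to 0 recovers the index of the
    old coefficient.\<close>
  define b where "b \<alpha> p = (deriv ^^ \<alpha> i) (\<lambda>t. a (\<alpha>(i := 0)) (upd p i t)) 0 / fact (\<alpha> i)" for \<alpha> p
  have b_le: "norm (b \<alpha> p) \<le> M / s ^ (\<Sum>j\<in>insert i S. \<alpha> j)" if p: "p \<in> polydisc r" for \<alpha> p
  proof -
    have "norm (b \<alpha> p) \<le> (M / s ^ (\<Sum>j\<in>S. (\<alpha>(i := 0)) j)) / s ^ \<alpha> i"
      unfolding b_def by (rule Taylor_coefficient_bound[OF s a_hol'[OF p]]) (use p in \<open>auto intro!: a_le simp del: fun_upd_apply\<close>)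
    then show ?thesis
      unfolding sum_fun_upd[OF insert.hyps(2)] using insert.hyps by (simp add: power_add mult.commute)
  qed
  have b_i: "b \<alpha> (upd p i t) = b \<alpha> p" for \<alpha> p t
    by (simp add: b_def)
  have b_hol: "separately_holomorphic r (b \<alpha>)" for \<alpha>
    unfolding separately_holomorphic_def
  proof (intro allI ballI)
    fix j and p :: "complex ^ 'n" assume p: "p \<in> polydisc r"
    show "(\<lambda>t. b \<alpha> (upd p j t)) holomorphic_on ball 0 r"
    proof (cases "j = i")
      case True
      then show ?thesis by (simp add: b_i)
    next
      case False
      show ?thesis
        unfolding b_def
      proof (rule holomorphic_Taylor_coefficient[OF r])
        show "(\<lambda>w. a (\<alpha>(i := 0)) (upd (upd p j w) i t)) holomorphic_on ball 0 r"
          if "t \<in> ball 0 r" for t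
          unfolding upd_commute[OF False] by (rule a_hol') (use p that in simp)
      qed (use p in \<open>auto intro!: a_hol' a_le\<close>)
    qed
  qed
  have b_indep: "b \<alpha> (upd p j t) = b \<alpha> p" if "j \<in> insert i S" for \<alpha> p j t
  proof (cases "j = i")
    case False
    then show ?thesis using that unfolding b_def upd_commute[OF False] by (simp add: a_indep)
  qed (simp add: b_i)
  have b_sum: "((\<lambda>\<alpha>. b \<alpha> p * (\<Prod>j\<in>insert i S. (p $ j) ^ \<alpha> j)) has_sum f p) (multi_indices (insert i S))"
    if p: "p \<in> polydisc s" for p
    unfolding has_sum_multi_indices_insert[OF insert.hyps]
  proof (rule has_sum_SigmaI)
    have p': "p \<in> polydisc r" using polydisc_mono[OF _ p] s by simp
    show "((\<lambda>\<alpha>. a \<alpha> p * (\<Prod>j\<in>S. (p $ j) ^ \<alpha> j)) has_sum f p) (multi_indices S)"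
      by (rule a_sum[OF p])
    \<comment> \<open>Summing iteratively is legitimate once the double family is known to be
      summable. The Cauchy bounds give a geometric majorant with ratios
      \<open>norm (p $ j) / s < 1\<close>.\<close>
    have "(\<lambda>\<alpha>. M * (\<Prod>j\<in>insert i S. (norm (p $ j) / s) ^ \<alpha> j)) summable_on multi_indices (insert i S)"
      by (intro summable_on_cmult_right has_sum_imp_summable[OF has_sum_multi_geometric])
         (use p s in \<open>auto simp: polydisc_def\<close>)
    then have "(\<lambda>\<alpha>. norm (b \<alpha> p * (\<Prod>j\<in>insert i S. (p $ j) ^ \<alpha> j))) summable_on multi_indices (insert i S)"
    proof (rule Infinite_Sum.abs_summable_on_comparison_test')
      fix \<alpha>
      have "norm (b \<alpha> p * (\<Prod>j\<in>insert i S. (p $ j) ^ \<alpha> j))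
            \<le> M / s ^ (\<Sum>j\<in>insert i S. \<alpha> j) * (\<Prod>j\<in>insert i S. norm (p $ j) ^ \<alpha> j)"
        unfolding norm_mult prod_norm[symmetric] norm_power
        by (intro mult_right_mono b_le p' prod_nonneg) auto
      also have "\<dots> = M * (\<Prod>j\<in>insert i S. (norm (p $ j) / s) ^ \<alpha> j)"
        by (simp only: power_divide prod_dividef power_sum) simp
      finally show "norm (b \<alpha> p * (\<Prod>j\<in>insert i S. (p $ j) ^ \<alpha> j)) \<le> \<dots>" .
    qed
    then have "(\<lambda>\<alpha>. b \<alpha> p * (\<Prod>j\<in>insert i S. (p $ j) ^ \<alpha> j)) summable_on multi_indices (insert i S)"
      by (rule Infinite_Sum.abs_summable_summable)
    then show "(\<lambda>(\<alpha>, n). b (\<alpha>(i := n)) p * (p $ i) ^ n * (\<Prod>j\<in>S. (p $ j) ^ \<alpha> j))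
                 summable_on multi_indices S \<times> UNIV"
      unfolding summable_on_def has_sum_multi_indices_insert[OF insert.hyps] .
    fix \<alpha> assume \<alpha>: "\<alpha> \<in> multi_indices S"
    then have [simp]: "\<alpha>(i := 0) = \<alpha>" using insert.hyps by (auto simp: multi_indices_def)
    have norm_p: "norm (p $ i) < s" using p by (rule polydisc_nth)
    have "((\<lambda>n. b (\<alpha>(i := n)) p * (p $ i) ^ n) has_sum a \<alpha> p) UNIV"
    proof (rule norm_summable_imp_has_sum)
      show "(\<lambda>n. b (\<alpha>(i := n)) p * (p $ i) ^ n) sums a \<alpha> p"
        using holomorphic_power_series[OF a_hol'[OF p', of \<alpha> i], of "p $ i"] norm_p s
        by (simp add: b_def)
      have summ: "summable (\<lambda>n. M / s ^ (\<Sum>j\<in>S. \<alpha> j) * (norm (p $ i) / s) ^ n)"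
        using norm_p s by (intro summable_mult summable_geometric) auto
      show "summable (\<lambda>n. norm (b (\<alpha>(i := n)) p * (p $ i) ^ n))"
      proof (rule summable_comparison_test'[OF summ])
        fix n
        have "(\<Sum>j\<in>insert i S. (\<alpha>(i := n)) j) = n + (\<Sum>j\<in>S. \<alpha> j)"
          using insert.hyps sum_fun_upd[OF insert.hyps(2)] by simp
        then have "norm (b (\<alpha>(i := n)) p) \<le> M / s ^ (n + (\<Sum>j\<in>S. \<alpha> j))"
          using b_le[OF p', of "\<alpha>(i := n)"] by simp
        then have "norm (b (\<alpha>(i := n)) p) * norm (p $ i) ^ n \<le> M / s ^ (n + (\<Sum>j\<in>S. \<alpha> j)) * norm (p $ i) ^ n"
          by (rule mult_right_mono) simp
        then show "norm (norm (b (\<alpha>(i := n)) p * (p $ i) ^ n)) \<le> M / s ^ (\<Sum>j\<in>S. \<alpha> j) * (norm (p $ i) / s) ^ n"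
          by (simp add: norm_mult norm_power power_add power_divide field_simps)
      qed
    qed
    then show "((\<lambda>n. case (\<alpha>, n) of (\<alpha>, n) \<Rightarrow> b (\<alpha>(i := n)) p * (p $ i) ^ n * (\<Prod>j\<in>S. (p $ j) ^ \<alpha> j))
                 has_sum a \<alpha> p * (\<Prod>j\<in>S. (p $ j) ^ \<alpha> j)) UNIV"
      by (simp add: has_sum_cmult_left)
  qed
  show ?case
    by (rule exI[of _ b]) (use b_le b_hol b_indep b_sum in blast)
qed

definition monomial :: "('n \<Rightarrow> nat) \<Rightarrow> complex ^ 'n::finite \<Rightarrow> complex" where
  "monomial \<alpha> p = (\<Prod>i\<in>UNIV. (p $ i) ^ \<alpha> i)"

lemma separately_holomorphic_expansion:
  fixes f :: "complex ^ 'n::finite \<Rightarrow> complex"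
  assumes s: "0 < s" "s < r"
    and hol: "separately_holomorphic r f"
    and bd: "\<And>p. p \<in> polydisc r \<Longrightarrow> norm (f p) \<le> M"
  obtains a where "\<And>\<alpha>. norm (a \<alpha>) \<le> M / s ^ (\<Sum>i\<in>UNIV. \<alpha> i)"
    "\<And>p. p \<in> polydisc s \<Longrightarrow> ((\<lambda>\<alpha>. a \<alpha> * monomial \<alpha> p) has_sum f p) UNIV"
proof -
  obtain a where a_le: "\<And>\<alpha> p. p \<in> polydisc r \<Longrightarrow> norm (a \<alpha> p) \<le> M / s ^ (\<Sum>i\<in>UNIV. \<alpha> i)"
    and a_indep: "\<And>\<alpha> p t j. a \<alpha> (upd p j t) = a \<alpha> p"
    and a_sum: "\<And>p. p \<in> polydisc s \<Longrightarrow> ((\<lambda>\<alpha>. a \<alpha> p * monomial \<alpha> p) has_sum f p) UNIV"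
    using separately_holomorphic_expansion_aux[OF s hol bd, of UNIV]
    unfolding monomial_def multi_indices_UNIV by blast
  \<comment> \<open>Independence is known for one coordinate at a time, so the coordinates of
    \<open>p\<close> are put into the zero vector one after another.\<close>
  have a_restrict: "a \<alpha> (\<chi> l. if l \<in> S then p $ l else 0) = a \<alpha> 0" for \<alpha> p and S :: "'n set"
    using finite[of S]
  proof (induction S rule: finite_induct)
    case empty
    have "(\<chi> l. if l \<in> {} then p $ l else 0) = (0 :: complex ^ 'n)" by (simp add: vec_eq_iff)
    then show ?case by simp
  next
    case (insert i S)
    have "(\<chi> l. if l \<in> insert i S then p $ l else 0) = upd (\<chi> l. if l \<in> S then p $ l else 0) i (p $ i)"
      by (simp add: vec_eq_iff)
    then show ?case using insert.IH a_indep by simp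
  qed
  have a_const: "a \<alpha> p = a \<alpha> 0" for \<alpha> p
    using a_restrict[of \<alpha> UNIV p] by simp
  have "(0 :: complex ^ 'n) \<in> polydisc r" using s by (simp add: polydisc_def)
  then show ?thesis
    using that[of "\<lambda>\<alpha>. a \<alpha> 0"] a_le a_sum by (metis (no_types, lifting) a_const has_sum_cong)
qed

subsection \<open>Termwise differentiation\<close>

text \<open>Asserts differentiability, which an equation for \<open>cpartial\<close>, being about
  \<open>deriv\<close>, would not. It is global because it is meant for finite partial sums, which
  are polynomials.\<close>

definition has_partial :: "'n::finite \<Rightarrow> (complex ^ 'n \<Rightarrow> complex) \<Rightarrow> (complex ^ 'n \<Rightarrow> complex) \<Rightarrow> bool" where
  "has_partial i f f' \<longleftrightarrow>
     (\<forall>p t. ((\<lambda>u. f (upd p i u)) has_field_derivative f' (upd p i t)) (at t))"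

lemma has_partial_cmult: "has_partial i f f' \<Longrightarrow> has_partial i (\<lambda>p. c * f p) (\<lambda>p. c * f' p)"
  by (auto simp: has_partial_def intro!: derivative_eq_intros)

lemma has_partial_sum:
  "(\<And>x. x \<in> A \<Longrightarrow> has_partial i (f x) (f' x)) \<Longrightarrow>
   has_partial i (\<lambda>p. \<Sum>x\<in>A. f x p) (\<lambda>p. \<Sum>x\<in>A. f' x p)"
  by (auto simp: has_partial_def intro!: derivative_eq_intros)

text \<open>Cauchy's inequality for the difference \<open>S n - f\<close> on discs in coordinate
  \<open>i\<close>, with one radius for all points. Differentiability of \<open>f\<close> in that
  coordinate comes from the uniform limit.\<close>

lemma uniform_limit_cpartial:
  fixes f :: "complex ^ 'n::finite \<Rightarrow> complex"
  assumes lim: "uniform_limit (polydisc r) S f F" and F: "F \<noteq> bot"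
    and S: "\<And>n. has_partial i (S n) (S' n)" and s: "s < r"
  shows "uniform_limit (polydisc s) S' (cpartial i f) F"
proof (rule uniform_limitI)
  fix e :: real assume e: "e > 0"
  \<comment> \<open>Half the gap keeps the closed disc of radius \<open>d\<close> about
    \<open>p $ i\<close> inside the disc of radius \<open>r\<close>. An error below
    \<open>e * d / 2\<close> then becomes at most \<open>e / 2\<close> for the derivative.\<close>
  define d where "d = (r - s) / 2"
  have d: "d > 0" using s by (simp add: d_def)
  have S_hol: "(\<lambda>u. S n (upd p i u)) holomorphic_on A" for n p A
    using S unfolding has_partial_def holomorphic_on_def
    by (meson field_differentiable_at_within field_differentiable_def)
  have f_hol: "(\<lambda>u. f (upd p i u)) holomorphic_on ball 0 r" if "p \<in> polydisc r" for p
  proof (rule holomorphic_on_uniform_limit)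
    show "uniform_limit (ball 0 r) (\<lambda>n u. S n (upd p i u)) (\<lambda>u. f (upd p i u)) F"
      using lim that unfolding uniform_limit_iff by (auto elim!: eventually_mono)
  qed (use F S_hol in auto)
  have "\<forall>\<^sub>F n in F. \<forall>p\<in>polydisc r. dist (S n p) (f p) < e * d / 2"
    by (rule uniform_limitD[OF lim]) (use e d in simp)
  then show "\<forall>\<^sub>F n in F. \<forall>p\<in>polydisc s. dist (S' n p) (cpartial i f p) < e"
  proof eventually_elim
    case (elim n)
    show ?case
    proof
      fix p :: "complex ^ 'n" assume p: "p \<in> polydisc s"
      then have p': "p \<in> polydisc r" using polydisc_mono[OF _ p] s by simp
      have sub: "cball (p $ i) d \<subseteq> ball 0 r"
      proof
        fix u assume "u \<in> cball (p $ i) d"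
        then have "norm u \<le> norm (p $ i) + d"
          using norm_triangle_ineq[of "p $ i" "u - p $ i"] by (simp add: dist_norm norm_minus_commute)
        then show "u \<in> ball 0 r"
          using polydisc_nth[OF p, of i] s by (simp add: d_def field_simps)
      qed
      define h where "h u = S n (upd p i u) - f (upd p i u)" for u
      have h_hol: "h holomorphic_on ball 0 r"
        unfolding h_def by (intro holomorphic_intros S_hol f_hol p')
      have "norm ((deriv ^^ 1) h (p $ i)) \<le> fact 1 * (e * d / 2) / d ^ 1"
      proof (rule Cauchy_inequality)
        show "h holomorphic_on ball (p $ i) d"
          by (rule holomorphic_on_subset[OF h_hol]) (use sub in auto)
        show "continuous_on (cball (p $ i) d) h"
          by (rule holomorphic_on_imp_continuous_on[OF holomorphic_on_subset[OF h_hol sub]])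
        fix u assume "norm (p $ i - u) = d"
        then have "norm u < r" using sub by (auto simp: subset_iff dist_norm)
        then show "norm (h u) \<le> e * d / 2"
          using elim upd_in_polydisc[OF p', of u i] by (auto simp: h_def dist_norm less_imp_le)
      qed (rule d)
      then have "norm (deriv h (p $ i)) < e" using d e by simp
      moreover have "deriv h (p $ i) = S' n p - cpartial i f p"
      proof -
        have 1: "((\<lambda>u. S n (upd p i u)) has_field_derivative S' n p) (at (p $ i))"
          using S[of n] unfolding has_partial_def by (metis upd_triv)
        have 2: "((\<lambda>u. f (upd p i u)) has_field_derivative cpartial i f p) (at (p $ i))"
          unfolding cpartial_upd
          by (rule holomorphic_derivI[OF f_hol[OF p'] open_ball]) (use polydisc_nth[OF p'] in simp)
        show ?thesis
          unfolding h_def by (rule DERIV_imp_deriv[OF DERIV_diff[OF 1 2]])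
      qed
      ultimately show "dist (S' n p) (cpartial i f p) < e" by (simp add: dist_norm)
    qed
  qed
qed

subsection \<open>Hermite series solve the equations\<close>

text \<open>Binomials vanish beyond the minimum, so Hermite polynomials of different degrees can be
  compared over one summation range.\<close>

lemma hermite_eq_sum:
  assumes "min m n \<le> N"
  shows "hermite m n x y z =
    (\<Sum>k\<le>N. fact k * of_nat (m choose k) * of_nat (n choose k) * x ^ (m - k) * y ^ (n - k) * z ^ k)"
  unfolding hermite_def
  by (rule sum.mono_neutral_left) (use assms in \<open>auto simp: min_def split: if_splits\<close>)

lemma hermite_commute: "hermite m n x y z = hermite n m y x z"
  by (simp add: hermite_def mult_ac min.commute)

text \<open>The factor \<open>m - k\<close> is absorbed by
  \<open>(m - k) * (m choose k) = m * (m - 1 choose k)\<close>. For \<open>m = 0\<close> both sides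
  vanish.\<close>

lemma DERIV_hermite_1:
  "((\<lambda>x. hermite m n x y z) has_field_derivative of_nat m * hermite (m - 1) n x y z) (at x)"
proof -
  have "((\<lambda>x. \<Sum>k\<le>n. fact k * of_nat (m choose k) * of_nat (n choose k) * x ^ (m - k) * y ^ (n - k) * z ^ k)
    has_field_derivative
     (\<Sum>k\<le>n. of_nat ((m - k) * (m choose k)) * (fact k * of_nat (n choose k) * x ^ (m - k - 1) * y ^ (n - k) * z ^ k)))
    (at x)"
    by (auto intro!: derivative_eq_intros sum.cong simp: mult_ac)
  also have "(\<Sum>k\<le>n. of_nat ((m - k) * (m choose k)) * (fact k * of_nat (n choose k) * x ^ (m - k - 1) * y ^ (n - k) * z ^ k))
      = of_nat m * hermite (m - 1) n x y z"
    unfolding binomial_absorb_comp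
    by (subst hermite_eq_sum[of "m - 1" n n]) (auto simp: sum_distrib_left mult_ac)
  finally show ?thesis
    by (simp add: hermite_eq_sum[of m n n, simplified])
qed

lemma DERIV_hermite_2:
  "((\<lambda>y. hermite m n x y z) has_field_derivative of_nat n * hermite m (n - 1) x y z) (at y)"
  using DERIV_hermite_1[of n m x z y] unfolding hermite_commute[of n m] hermite_commute[of "n - 1" m] .

text \<open>Besides the \<open>k\<close> from \<open>z ^ k\<close>, the factorial
  \<open>fact k\<close> releases a second one; each is absorbed by one binomial through
  \<open>k * (m choose k) = m * (m - 1 choose k - 1)\<close>. The result is what differentiating in
  \<open>x\<close> and \<open>y\<close> gives.\<close>

lemma DERIV_hermite_3:
  "((\<lambda>z. hermite m n x y z) has_field_derivative
     of_nat m * (of_nat n * hermite (m - 1) (n - 1) x y z)) (at z)"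
proof -
  \<comment> \<open>The range ends at \<open>Suc n\<close> so that it ends at \<open>n\<close> after
    the vanishing term \<open>k = 0\<close> is dropped and the index shifted.\<close>
  have "((\<lambda>z. \<Sum>k\<le>Suc n. fact k * of_nat (m choose k) * of_nat (n choose k) * x ^ (m - k) * y ^ (n - k) * z ^ k)
    has_field_derivative
     (\<Sum>k\<le>Suc n. fact k * of_nat (m choose k) * of_nat (n choose k) * x ^ (m - k) * y ^ (n - k) * (of_nat k * z ^ (k - 1))))
    (at z)"
    by (auto intro!: derivative_eq_intros sum.cong simp: mult_ac simp del: sum.atMost_Suc)
  also have "(\<Sum>k\<le>Suc n. fact k * of_nat (m choose k) * of_nat (n choose k) * x ^ (m - k) * y ^ (n - k) * (of_nat k * z ^ (k - 1)))
     = (\<Sum>k\<le>n. fact k * of_nat (Suc k * (m choose Suc k)) * of_nat (Suc k * (n choose Suc k))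
          * x ^ (m - Suc k) * y ^ (n - Suc k) * z ^ k)"
    unfolding sum.atMost_Suc_shift fact_Suc of_nat_mult by (simp add: mult_ac del: of_nat_Suc)
  also have "\<dots> = of_nat m * (of_nat n * hermite (m - 1) (n - 1) x y z)"
    unfolding binomial_absorption
    by (subst hermite_eq_sum[of "m - 1" "n - 1" n]) (auto simp: sum_distrib_left mult_ac)
  finally show ?thesis
    by (simp add: hermite_eq_sum[of m n "Suc n", simplified])
qed

definition hermite_prod :: "('k::finite \<Rightarrow> nat) \<Rightarrow> ('k \<Rightarrow> nat) \<Rightarrow> complex ^ ('k \<times> 3) \<Rightarrow> complex" where
  "hermite_prod m n p = (\<Prod>j\<in>UNIV. hermite (m j) (n j) (p $ (j, 1)) (p $ (j, 2)) (p $ (j, 3)))"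

lemma hermite_term_eq: "hermite_term c (m, n) = (\<lambda>p. c (m, n) * hermite_prod m n p)"
  by (simp add: fun_eq_iff hermite_term_def hermite_prod_def)

lemma hermite_prod_split:
  "hermite_prod m n p = hermite (m j) (n j) (p $ (j, 1)) (p $ (j, 2)) (p $ (j, 3)) *
     (\<Prod>l\<in>-{j}. hermite (m l) (n l) (p $ (l, 1)) (p $ (l, 2)) (p $ (l, 3)))"
  unfolding hermite_prod_def Compl_eq_Diff_UNIV by (rule prod.remove) auto

text \<open>A congruence rule for the simplifier: knowing \<open>l \<noteq> j\<close>, it sees that
  the remaining factors ignore the updated coordinate.\<close>

lemma prod_Compl_cong:
  "(\<And>l. l \<noteq> j \<Longrightarrow> f l = g l) \<Longrightarrow> (\<Prod>l\<in>-{j}. f l) = (\<Prod>l\<in>-{j}. g l)"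
  by (rule prod.cong) auto

lemma has_partial_hermite_prod:
  fixes m n :: "'k::finite \<Rightarrow> nat"
  shows "has_partial (j, 1) (hermite_prod m n) (\<lambda>p. of_nat (m j) * hermite_prod (m(j := m j - 1)) n p)"
    and "has_partial (j, 2) (hermite_prod m n) (\<lambda>p. of_nat (n j) * hermite_prod m (n(j := n j - 1)) p)"
    and "has_partial (j, 3) (hermite_prod m n)
           (\<lambda>p. of_nat (m j) * (of_nat (n j) * hermite_prod (m(j := m j - 1)) (n(j := n j - 1)) p))"
  unfolding has_partial_def hermite_prod_split[where j = j]
  by (auto intro!: derivative_eq_intros DERIV_hermite_1 DERIV_hermite_2 DERIV_hermite_3
        simp: mult_ac cong: prod_Compl_cong)

lemma hermite_series_imp_pde:
  fixes f :: "complex ^ ('k::finite \<times> 3) \<Rightarrow> complex"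
  assumes "open U" "0 \<in> U" "hermite_series_on c f U"
  shows "\<forall>\<^sub>F p in nhds 0. cpartial (j, 3) f p = cpartial (j, 1) (cpartial (j, 2) f) p"
proof -
  let ?F = "finite_subsets_at_top (UNIV :: (('k \<Rightarrow> nat) \<times> ('k \<Rightarrow> nat)) set)"
  obtain r where r: "r > 0" "polydisc r \<subseteq> U"
    using assms(1,2) by (metis openE polydisc_subset_ball subset_trans)
  define S where "S A p = (\<Sum>mn\<in>A. hermite_term c mn p)" for A p
  define S2 where "S2 A p = (\<Sum>(m, n)\<in>A. c (m, n) * (of_nat (n j) * hermite_prod m (n(j := n j - 1)) p))" for A p
  \<comment> \<open>Both the \<open>z_j\<close> derivative and the iterated derivative of the
    partial sums equal \<open>S3\<close>, so the two sides of the equation are limits of the same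
    net.\<close>
  define S3 where "S3 A p = (\<Sum>(m, n)\<in>A. c (m, n) *
      (of_nat (n j) * (of_nat (m j) * hermite_prod (m(j := m j - 1)) (n(j := n j - 1)) p)))" for A p
  have d2: "has_partial (j, 2) (S A) (S2 A)" for A
    unfolding S_def S2_def
    by (intro has_partial_sum, clarify, simp only: hermite_term_eq prod.case)
       (intro has_partial_cmult has_partial_hermite_prod)
  have d12: "has_partial (j, 1) (S2 A) (S3 A)" for A
    unfolding S2_def S3_def case_prod_unfold
    by (intro has_partial_sum has_partial_cmult has_partial_hermite_prod)
  have d3: "has_partial (j, 3) (S A) (S3 A)" for A
    unfolding S_def S3_def
    by (intro has_partial_sum, clarify, simp only: hermite_term_eq prod.case, subst mult.left_commute)
       (intro has_partial_cmult has_partial_hermite_prod)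
  have lim: "uniform_limit (polydisc r) S f ?F"
    using assms(3) r(2) unfolding hermite_series_on_def S_def[abs_def] by (blast intro: uniform_limit_on_subset)
  have F: "?F \<noteq> bot" by simp
  \<comment> \<open>Each differentiation costs a smaller radius: \<open>r / 2\<close> after one,
    \<open>r / 4\<close> after two.\<close>
  have lim2: "uniform_limit (polydisc (r / 2)) S2 (cpartial (j, 2) f) ?F"
    by (rule uniform_limit_cpartial[OF lim F d2]) (use r in simp)
  have lim12: "uniform_limit (polydisc (r / 4)) S3 (cpartial (j, 1) (cpartial (j, 2) f)) ?F"
    by (rule uniform_limit_cpartial[OF lim2 F d12]) (use r in simp)
  have lim3: "uniform_limit (polydisc (r / 4)) S3 (cpartial (j, 3) f) ?F"
    by (rule uniform_limit_cpartial[OF lim F d3]) (use r in simp)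
  have "cpartial (j, 3) f p = cpartial (j, 1) (cpartial (j, 2) f) p" if "p \<in> polydisc (r / 4)" for p
    using tendsto_unique[OF F tendsto_uniform_limitI[OF lim3 that] tendsto_uniform_limitI[OF lim12 that]] .
  moreover have "0 \<in> (polydisc (r / 4) :: (complex ^ ('k \<times> 3)) set)"
    using r by (simp add: polydisc_def)
  ultimately show ?thesis
    unfolding eventually_nhds using open_polydisc by blast
qed

subsection \<open>Solutions are Hermite series\<close>

lemma prod_fun_upd_UNIV:
  fixes \<alpha> :: "'n::finite \<Rightarrow> 'b"
  shows "(\<Prod>l\<in>UNIV. F l ((\<alpha>(i := n)) l)) = F i n * (\<Prod>l\<in>-{i}. F l (\<alpha> l))"
proof -
  have "(\<Prod>l\<in>UNIV. F l ((\<alpha>(i := n)) l)) = F i n * (\<Prod>l\<in>-{i}. F l ((\<alpha>(i := n)) l))"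
    unfolding Compl_eq_Diff_UNIV by (subst prod.remove[of _ i]) auto
  then show ?thesis using prod_fun_upd[of i "-{i}" F] by simp
qed

lemma monomial_split: "monomial \<alpha> p = (p $ i) ^ \<alpha> i * (\<Prod>l\<in>-{i}. (p $ l) ^ \<alpha> l)"
  unfolding monomial_def using prod_fun_upd_UNIV[of "\<lambda>l. (^) (p $ l)" \<alpha> i "\<alpha> i"] by simp

lemma has_partial_monomial:
  "has_partial i (monomial \<alpha>) (\<lambda>p. of_nat (\<alpha> i) * monomial (\<alpha>(i := \<alpha> i - 1)) p)"
  unfolding has_partial_def monomial_split[where i = i]
  by (auto intro!: derivative_eq_intros simp: mult_ac cong: prod_Compl_cong)

text \<open>In a differentiated series the factor \<open>\<alpha> i\<close> kills the terms with
  \<open>\<alpha> i = 0\<close>; the surviving indices are exactly the raised ones.\<close>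

lemma has_sum_shift:
  fixes g :: "('n \<Rightarrow> nat) \<Rightarrow> complex"
  assumes "\<And>\<alpha>. \<alpha> i = 0 \<Longrightarrow> g \<alpha> = 0" "(g has_sum L) UNIV"
  shows "((\<lambda>\<beta>. g (\<beta>(i := Suc (\<beta> i)))) has_sum L) UNIV"
proof -
  let ?h = "\<lambda>\<beta> :: 'n \<Rightarrow> nat. \<beta>(i := Suc (\<beta> i))"
  have "inj ?h"
  proof (rule injI)
    fix \<beta> \<gamma> assume "?h \<beta> = ?h \<gamma>"
    then have "?h \<beta> l = ?h \<gamma> l" for l by simp
    then show "\<beta> = \<gamma>" by (metis fun_upd_apply nat.inject ext)
  qed
  moreover have "(g has_sum L) (range ?h)"
  proof -
    have "\<alpha> \<in> range ?h" if "\<alpha> i \<noteq> 0" for \<alpha>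
      by (rule range_eqI[of _ _ "\<alpha>(i := \<alpha> i - 1)"]) (use that in auto)
    then have "(g has_sum L) (range ?h) \<longleftrightarrow> (g has_sum L) UNIV"
      by (intro has_sum_cong_neutral) (use assms(1) in auto)
    then show ?thesis using assms(2) by simp
  qed
  ultimately show ?thesis
    using has_sum_reindex[of ?h UNIV g L] by (simp add: o_def)
qed

lemma norm_power_series_term_le:
  assumes "norm (a \<alpha>) \<le> M / s ^ (\<Sum>i\<in>UNIV. \<alpha> i)" "p \<in> polydisc q"
  shows "norm (a \<alpha> * monomial \<alpha> p) \<le> M * (\<Prod>i\<in>UNIV. (q / s) ^ \<alpha> i)"
proof -
  have "norm (a \<alpha> * monomial \<alpha> p) \<le> M / s ^ (\<Sum>i\<in>UNIV. \<alpha> i) * (\<Prod>i\<in>UNIV. q ^ \<alpha> i)"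
    unfolding norm_mult monomial_def prod_norm[symmetric] norm_power
    by (intro mult_mono assms(1) prod_mono conjI power_mono prod_nonneg ballI order_trans[OF norm_ge_zero assms(1)])
       (use polydisc_nth[OF assms(2)] in \<open>auto simp: less_imp_le\<close>)
  also have "\<dots> = M * (\<Prod>i\<in>UNIV. (q / s) ^ \<alpha> i)"
    by (simp only: power_divide prod_dividef power_sum) simp
  finally show ?thesis .
qed

lemma summable_on_power_series_majorant:
  fixes q s M :: real
  assumes "0 \<le> q" "q < s"
  shows "(\<lambda>\<alpha> :: 'n::finite \<Rightarrow> nat. M * (\<Prod>i\<in>UNIV. (q / s) ^ \<alpha> i)) summable_on UNIV"
  using has_sum_multi_geometric[of UNIV "\<lambda>_ :: 'n. q / s"] assms
  by (intro summable_on_cmult_right has_sum_imp_summable) auto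

text \<open>Both sides of the equation are differentiated termwise and their coefficients compared.
  Since \<open>x \<noteq> y\<close>, raising one of these exponents leaves the factor belonging to
  the other unchanged.\<close>

lemma pde_imp_coefficient_recurrence:
  fixes a :: "('n::finite \<Rightarrow> nat) \<Rightarrow> complex"
  assumes s: "0 < s"
    and a_le: "\<And>\<alpha>. norm (a \<alpha>) \<le> M / s ^ (\<Sum>i\<in>UNIV. \<alpha> i)"
    and f: "\<And>p. p \<in> polydisc s \<Longrightarrow> ((\<lambda>\<alpha>. a \<alpha> * monomial \<alpha> p) has_sum f p) UNIV"
    and pde: "\<And>p. p \<in> polydisc s \<Longrightarrow> cpartial z f p = cpartial x (cpartial y f) p"
    and xy: "x \<noteq> y"
  shows "of_nat (Suc (\<beta> z)) * a (\<beta>(z := Suc (\<beta> z))) =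
         of_nat (Suc (\<beta> x)) * of_nat (Suc (\<beta> y)) * a (\<beta>(x := Suc (\<beta> x), y := Suc (\<beta> y)))"
proof -
  let ?F = "finite_subsets_at_top (UNIV :: ('n \<Rightarrow> nat) set)"
  have F: "?F \<noteq> bot" by simp
  \<comment> \<open>\<open>D i\<close> acts on coefficients as the partial derivative in coordinate
    \<open>i\<close> acts on the series.\<close>
  define D where "D i c \<alpha> = of_nat (Suc (\<alpha> i)) * c (\<alpha>(i := Suc (\<alpha> i)))" for i and c :: "('n \<Rightarrow> nat) \<Rightarrow> complex" and \<alpha>
  let ?m' = "\<lambda>i \<alpha> p. of_nat (\<alpha> i) * monomial (\<alpha>(i := \<alpha> i - 1)) p"
  let ?m'' = "\<lambda>\<alpha> p. of_nat (\<alpha> y) * ?m' x (\<alpha>(y := \<alpha> y - 1)) p"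
  have lim: "uniform_limit (polydisc (s / 2)) (\<lambda>A p. \<Sum>\<alpha>\<in>A. a \<alpha> * monomial \<alpha> p) f ?F"
  proof (rule Weierstrass_m_test_general')
    show "(\<lambda>\<alpha> :: 'n \<Rightarrow> nat. M * (\<Prod>i\<in>UNIV. (s / 2 / s) ^ \<alpha> i)) summable_on UNIV"
      by (rule summable_on_power_series_majorant) (use s in auto)
    show "((\<lambda>\<alpha>. a \<alpha> * monomial \<alpha> p) has_sum f p) UNIV" if "p \<in> polydisc (s / 2)" for p
      by (rule f[OF polydisc_mono[OF _ that]]) (use s in simp)
  qed (rule norm_power_series_term_le[OF a_le])
  have lim1: "uniform_limit (polydisc (s / 4)) (\<lambda>A p. \<Sum>\<alpha>\<in>A. a \<alpha> * ?m' i \<alpha> p) (cpartial i f) ?F" for i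
    by (rule uniform_limit_cpartial[OF lim F])
       (intro has_partial_sum has_partial_cmult has_partial_monomial, use s in simp)
  have lim2: "uniform_limit (polydisc (s / 8)) (\<lambda>A p. \<Sum>\<alpha>\<in>A. a \<alpha> * ?m'' \<alpha> p) (cpartial x (cpartial y f)) ?F"
    by (rule uniform_limit_cpartial[OF lim1 F])
       (intro has_partial_sum has_partial_cmult has_partial_monomial, use s in simp)
  have "D z a \<beta> - D x (D y a) \<beta> = 0" for \<beta>
  proof (rule multi_power_series_unique[where S = UNIV and r = "s / 8"])
    fix p :: "complex ^ 'n" assume p: "p \<in> polydisc (s / 8)"
    have p4: "p \<in> polydisc (s / 4)" by (rule polydisc_mono[OF _ p]) (use s in simp)
    have "((\<lambda>\<alpha>. a \<alpha> * ?m' z \<alpha> p) has_sum cpartial z f p) UNIV"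
      unfolding has_sum_def by (rule tendsto_uniform_limitI[OF lim1 p4])
    from has_sum_shift[where i = z, OF _ this]
    have 1: "((\<lambda>\<alpha>. D z a \<alpha> * monomial \<alpha> p) has_sum cpartial z f p) UNIV"
      by (simp add: D_def mult_ac)
    have "((\<lambda>\<alpha>. a \<alpha> * ?m'' \<alpha> p) has_sum cpartial x (cpartial y f) p) UNIV"
      unfolding has_sum_def by (rule tendsto_uniform_limitI[OF lim2 p])
    from has_sum_shift[where i = y, OF _ this]
    have "((\<lambda>\<alpha>. D y a \<alpha> * ?m' x \<alpha> p) has_sum cpartial x (cpartial y f) p) UNIV"
      by (simp add: D_def mult_ac)
    from has_sum_shift[where i = x, OF _ this]
    have 2: "((\<lambda>\<alpha>. D x (D y a) \<alpha> * monomial \<alpha> p) has_sum cpartial x (cpartial y f) p) UNIV"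
      by (simp add: D_def[of x] mult_ac)
    have "p \<in> polydisc s" by (rule polydisc_mono[OF _ p]) (use s in simp)
    then show "((\<lambda>\<alpha>. (D z a \<alpha> - D x (D y a) \<alpha>) * (\<Prod>i\<in>UNIV. (p $ i) ^ \<alpha> i)) has_sum 0) (multi_indices UNIV)"
      using has_sum_add[OF 1 has_sum_uminusI[OF 2]] pde by (simp add: monomial_def algebra_simps)
  qed (use s in auto)
  from this[of \<beta>] show ?thesis using xy by (simp add: D_def mult_ac)
qed

section \<open>Grouping monomials into Hermite products\<close>

text \<open>The multi-index of the monomial \<open>\<Prod>j. x\<^sub>j ^ (m\<^sub>j - k\<^sub>j) * y\<^sub>j ^ (n\<^sub>j - k\<^sub>j) * z\<^sub>j ^ k\<^sub>j\<close>.\<close>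

definition hermite_index :: "('k \<Rightarrow> nat) \<times> ('k \<Rightarrow> nat) \<Rightarrow> ('k \<Rightarrow> nat) \<Rightarrow> 'k \<times> 3 \<Rightarrow> nat" where
  "hermite_index mn k = (\<lambda>(j, l). if l = 1 then fst mn j - k j else if l = 2 then snd mn j - k j else k j)"

lemma hermite_index_simps [simp]:
  "hermite_index mn k (j, 1) = fst mn j - k j"
  "hermite_index mn k (j, 2) = snd mn j - k j"
  "hermite_index mn k (j, 3) = k j"
  by (simp_all add: hermite_index_def)

lemma index3_eqI:
  assumes "\<And>j. \<alpha> (j, 1) = \<beta> (j, 1)" "\<And>j. \<alpha> (j, 2) = \<beta> (j, 2)" "\<And>j. \<alpha> (j, 3) = \<beta> (j, 3)"
  shows "\<alpha> = (\<beta> :: 'k \<times> 3 \<Rightarrow> 'b)"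
proof
  fix i :: "'k \<times> 3"
  obtain j l where i: "i = (j, l)" by (cases i)
  show "\<alpha> i = \<beta> i" unfolding i using exhaust_3[of l] by (elim disjE) (simp_all only: assms)
qed

lemma prod_index3:
  fixes F :: "'k::finite \<times> 3 \<Rightarrow> 'b::comm_monoid_mult"
  shows "(\<Prod>i\<in>UNIV. F i) = (\<Prod>j\<in>UNIV. F (j, 1) * F (j, 2) * F (j, 3))"
proof -
  have "(\<Prod>i\<in>UNIV. F i) = (\<Prod>j\<in>UNIV. \<Prod>l\<in>UNIV. F (j, l))"
    by (simp add: prod.cartesian_product flip: UNIV_Times_UNIV)
  also have "\<dots> = (\<Prod>j\<in>UNIV. F (j, 1) * F (j, 2) * F (j, 3))"
    unfolding UNIV_3 by (rule prod.cong) (simp_all add: mult.assoc)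
  finally show ?thesis .
qed

text \<open>The index set that \<open>prod_sum_PiE\<close> yields when a product of Hermite sums is
  multiplied out; over \<open>UNIV\<close> extensionality is no restriction.\<close>

definition hermite_range :: "('k \<Rightarrow> nat) \<times> ('k \<Rightarrow> nat) \<Rightarrow> ('k \<Rightarrow> nat) set" where
  "hermite_range mn = (\<Pi>\<^sub>E j\<in>UNIV. {0..min (fst mn j) (snd mn j)})"

lemma finite_hermite_range: "finite (hermite_range (mn :: ('k::finite \<Rightarrow> nat) \<times> ('k \<Rightarrow> nat)))"
  by (simp add: hermite_range_def finite_PiE)

lemma hermite_range_iff: "k \<in> hermite_range mn \<longleftrightarrow> (\<forall>j. k j \<le> fst mn j \<and> k j \<le> snd mn j)"
  by (auto simp: hermite_range_def PiE_iff)

text \<open>The bounds on \<open>k\<close> keep the subtractions in \<open>hermite_index\<close>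
  from truncating, so adding the \<open>z_j\<close> exponent back recovers
  \<open>mn\<close>.\<close>

lemma bij_betw_hermite_index:
  "bij_betw (\<lambda>(mn, k). hermite_index mn k) (Sigma UNIV hermite_range) UNIV"
proof (rule bij_betwI[where g = "\<lambda>\<alpha>. ((\<lambda>j. \<alpha> (j, 1) + \<alpha> (j, 3), \<lambda>j. \<alpha> (j, 2) + \<alpha> (j, 3)), \<lambda>j. \<alpha> (j, 3))"])
  show "(\<lambda>\<alpha>. ((\<lambda>j. \<alpha> (j, 1) + \<alpha> (j, 3), \<lambda>j. \<alpha> (j, 2) + \<alpha> (j, 3)), \<lambda>j. \<alpha> (j, 3)))
          \<in> UNIV \<rightarrow> Sigma UNIV (hermite_range :: ('k \<Rightarrow> nat) \<times> ('k \<Rightarrow> nat) \<Rightarrow> _)"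
    by (auto simp: hermite_range_iff)
qed (auto simp: hermite_range_iff intro!: index3_eqI)

text \<open>Multiplying by the factorials absorbs the integer factors of the recurrence:
  \<open>b\<close> takes equal values at neighbouring indices. Lowering one \<open>k j\<close> at a
  time leads to \<open>k = 0\<close>, whose coefficient is the Hermite coefficient.\<close>

lemma hermite_term_eq_sum_monomials:
  fixes a :: "('k::finite \<times> 3 \<Rightarrow> nat) \<Rightarrow> complex"
  assumes rec: "\<And>j \<beta>. of_nat (Suc (\<beta> (j, 3))) * a (\<beta>((j, 3) := Suc (\<beta> (j, 3)))) =
         of_nat (Suc (\<beta> (j, 1))) * of_nat (Suc (\<beta> (j, 2))) *
           a (\<beta>((j, 1) := Suc (\<beta> (j, 1)), (j, 2) := Suc (\<beta> (j, 2))))"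
  shows "hermite_term (\<lambda>mn. a (hermite_index mn (\<lambda>_. 0))) mn p =
         (\<Sum>k\<in>hermite_range mn. a (hermite_index mn k) * monomial (hermite_index mn k) p)"
proof -
  define facts :: "('k \<times> 3 \<Rightarrow> nat) \<Rightarrow> complex" where "facts \<alpha> = (\<Prod>i\<in>UNIV. fact (\<alpha> i))" for \<alpha>
  have facts_nz: "facts \<alpha> \<noteq> 0" for \<alpha> by (simp add: facts_def)
  have facts_Suc: "facts (\<alpha>(i := Suc (\<alpha> i))) = of_nat (Suc (\<alpha> i)) * facts \<alpha>" for \<alpha> i
    using prod_fun_upd_UNIV[of "\<lambda>_ n. fact n :: complex" \<alpha> i "Suc (\<alpha> i)"]
          prod_fun_upd_UNIV[of "\<lambda>_ n. fact n :: complex" \<alpha> i "\<alpha> i"]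
    unfolding facts_def by (simp add: mult.assoc)
  define b where "b \<alpha> = a \<alpha> * facts \<alpha>" for \<alpha>
  have b_rec: "b (\<beta>((j, 3) := Suc (\<beta> (j, 3)))) =
      b (\<beta>((j, 1) := Suc (\<beta> (j, 1)), (j, 2) := Suc (\<beta> (j, 2))))" for \<beta> j
    using rec[of \<beta> j] facts_Suc[of \<beta> "(j, 3)"] facts_Suc[of \<beta> "(j, 1)"]
      facts_Suc[of "\<beta>((j, 1) := Suc (\<beta> (j, 1)))" "(j, 2)"]
    by (simp add: b_def mult_ac del: of_nat_Suc)
  have b_const: "b (hermite_index mn k) = b (hermite_index mn (\<lambda>_. 0))" if "k \<in> hermite_range mn" for k
    using that
  proof (induction "\<Sum>j\<in>UNIV. k j" arbitrary: k)
    case 0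
    then have "k = (\<lambda>_. 0)" by (simp add: fun_eq_iff)
    then show ?case by simp
  next
    case (Suc N)
    then obtain j where j: "k j > 0" by (metis gr0I sum.neutral nat.distinct(1))
    define k' where "k' = k(j := k j - 1)"
    \<comment> \<open>A common lower neighbour: raising its \<open>z_j\<close> exponent gives the
      index of \<open>k\<close>, raising its \<open>x_j\<close> and \<open>y_j\<close> exponents
      gives that of \<open>k'\<close>.\<close>
    define \<beta> where "\<beta> = (hermite_index mn k)((j, 3) := k j - 1)"
    have k_le: "k l \<le> fst mn l" "k l \<le> snd mn l" for l
      using Suc.prems by (auto simp: hermite_range_iff)
    have "(\<Sum>l\<in>UNIV. k l) = k j + (\<Sum>l\<in>UNIV - {j}. k l)" by (rule sum.remove) auto
    moreover have "(\<Sum>l\<in>UNIV. k' l) = k' j + (\<Sum>l\<in>UNIV - {j}. k' l)" by (rule sum.remove) auto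
    moreover have "(\<Sum>l\<in>UNIV - {j}. k' l) = (\<Sum>l\<in>UNIV - {j}. k l)" by (rule sum.cong) (auto simp: k'_def)
    ultimately have "N = (\<Sum>l\<in>UNIV. k' l)" using Suc.hyps(2) j by (simp add: k'_def)
    moreover have "k' \<in> hermite_range mn"
      using k_le by (auto simp: hermite_range_iff k'_def intro: le_trans[OF diff_le_self])
    ultimately have IH: "b (hermite_index mn k') = b (hermite_index mn (\<lambda>_. 0))"
      by (rule Suc.hyps(1))
    have "hermite_index mn k = \<beta>((j, 3) := Suc (\<beta> (j, 3)))"
      using j by (simp add: \<beta>_def fun_eq_iff)
    moreover have "hermite_index mn k' = \<beta>((j, 1) := Suc (\<beta> (j, 1)), (j, 2) := Suc (\<beta> (j, 2)))"
      by (rule index3_eqI) (use j k_le[of j] in \<open>auto simp: \<beta>_def k'_def\<close>)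
    ultimately show ?case using b_rec IH by simp
  qed
  have expand: "hermite_prod (fst mn) (snd mn) p =
      (\<Sum>k\<in>hermite_range mn. facts (hermite_index mn (\<lambda>_. 0)) / facts (hermite_index mn k)
          * monomial (hermite_index mn k) p)"
    unfolding hermite_prod_def hermite_def hermite_range_def
  proof (subst prod_sum_PiE, simp, simp, rule sum.cong[OF refl])
    fix k assume "k \<in> (\<Pi>\<^sub>E j\<in>UNIV. {0..min (fst mn j) (snd mn j)})"
    then have k: "k j \<le> fst mn j" "k j \<le> snd mn j" for j by (auto simp: PiE_iff)
    show "(\<Prod>j\<in>UNIV. fact (k j) * of_nat (fst mn j choose k j) * of_nat (snd mn j choose k j)
              * (p $ (j, 1)) ^ (fst mn j - k j) * (p $ (j, 2)) ^ (snd mn j - k j) * (p $ (j, 3)) ^ k j) =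
          facts (hermite_index mn (\<lambda>_. 0)) / facts (hermite_index mn k) * monomial (hermite_index mn k) p"
      unfolding facts_def monomial_def prod_index3 prod_dividef[symmetric] prod.distrib[symmetric]
      by (rule prod.cong) (simp_all add: binomial_fact k mult_ac)
  qed
  have coeff: "a (hermite_index mn (\<lambda>_. 0)) * (facts (hermite_index mn (\<lambda>_. 0)) / facts (hermite_index mn k))
      = a (hermite_index mn k)" if "k \<in> hermite_range mn" for k
    using b_const[OF that] facts_nz by (simp add: b_def field_simps)
  have "hermite_term (\<lambda>mn. a (hermite_index mn (\<lambda>_. 0))) mn p =
      a (hermite_index mn (\<lambda>_. 0)) * hermite_prod (fst mn) (snd mn) p"
    by (cases mn) (simp add: hermite_term_eq)
  then show ?thesis
    unfolding expand sum_distrib_left mult.assoc[symmetric]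
    by (simp only: coeff[unfolded mult.assoc[symmetric]] cong: sum.cong)
qed

section \<open>Convergence of the Hermite series of a solution\<close>

lemma pde_imp_hermite_series:
  fixes f :: "complex ^ ('k::finite \<times> 3) \<Rightarrow> complex"
  assumes analytic: "sv_analytic_at f 0"
    and pde: "\<And>j. \<forall>\<^sub>F p in nhds 0. cpartial (j, 3) f p = cpartial (j, 1) (cpartial (j, 2) f) p"
  shows "\<exists>c U. open U \<and> 0 \<in> U \<and> hermite_series_on c f U"
proof -
  obtain U where U: "open U" "0 \<in> U" "sv_holomorphic_on f U"
    using analytic by (auto simp: sv_analytic_at_def)
  then obtain D where "(f has_derivative D) (at 0)"
    by (auto simp: sv_holomorphic_on_def)
  \<comment> \<open>Continuity at the origin bounds \<open>f\<close> on some polydisc, as the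
    expansion requires.\<close>
  then have "isCont f 0" by (rule has_derivative_continuous)
  then have "\<forall>\<^sub>F p in nhds 0. norm (f p) < norm (f 0) + 1"
    by (intro order_tendstoD(2)[where y = "norm (f 0)"] tendsto_norm)
       (auto simp: continuous_at tendsto_at_iff_tendsto_nhds)
  moreover have "\<forall>\<^sub>F p in nhds 0. p \<in> U"
    using U by (simp add: eventually_nhds_in_open)
  moreover have "\<forall>\<^sub>F p in nhds 0. \<forall>j. cpartial (j, 3) f p = cpartial (j, 1) (cpartial (j, 2) f) p"
    by (intro eventually_all_finite pde)
  ultimately have "\<forall>\<^sub>F p in nhds 0. norm (f p) < norm (f 0) + 1 \<and> p \<in> U \<and>
      (\<forall>j. cpartial (j, 3) f p = cpartial (j, 1) (cpartial (j, 2) f) p)"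
    by eventually_elim auto
  then obtain r where r: "r > 0" and near: "\<And>p. p \<in> polydisc r \<Longrightarrow> norm (f p) < norm (f 0) + 1 \<and> p \<in> U \<and>
      (\<forall>j. cpartial (j, 3) f p = cpartial (j, 1) (cpartial (j, 2) f) p)"
    by (rule eventually_nhds_0_polydisc) blast
  define s where "s = r / 2"
  define M where "M = norm (f 0) + 1"
  have s: "0 < s" "s < r" using r by (auto simp: s_def)
  have "separately_holomorphic r f"
    by (rule sv_holomorphic_on_imp_separately_holomorphic[OF U(3)]) (use near in blast)
  moreover have "norm (f p) \<le> M" if "p \<in> polydisc r" for p
    using near[OF that] by (simp add: M_def)
  ultimately obtain a where a_le: "\<And>\<alpha>. norm (a \<alpha>) \<le> M / s ^ (\<Sum>i\<in>UNIV. \<alpha> i)"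
    and a_sum: "\<And>p. p \<in> polydisc s \<Longrightarrow> ((\<lambda>\<alpha>. a \<alpha> * monomial \<alpha> p) has_sum f p) UNIV"
    using separately_holomorphic_expansion[OF s] by blast
  have near_s: "p \<in> polydisc r" if "p \<in> polydisc s" for p :: "complex ^ ('k \<times> 3)"
    by (rule polydisc_mono[OF _ that]) (use s in simp)
  define c where "c mn = a (hermite_index mn (\<lambda>_. 0))" for mn
  have term_eq: "hermite_term c mn p =
      (\<Sum>k\<in>hermite_range mn. a (hermite_index mn k) * monomial (hermite_index mn k) p)" for mn p
    unfolding c_def
    by (intro hermite_term_eq_sum_monomials pde_imp_coefficient_recurrence[OF s(1) a_le a_sum])
       (use near near_s in auto)
  define q where "q = s / 2"
  have q: "0 < q" "q < s" using s by (auto simp: q_def)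
  define G where "G \<alpha> = M * (\<Prod>i\<in>UNIV. (q / s) ^ \<alpha> i)" for \<alpha> :: "'k \<times> 3 \<Rightarrow> nat"
  \<comment> \<open>The majorant summed over the finite group of monomials of one Hermite term; it
    serves both absolute convergence and the M-test.\<close>
  define H where "H mn = (\<Sum>k\<in>hermite_range mn. G (hermite_index mn k))" for mn
  \<comment> \<open>Kept general in the value type: it is applied to the complex power series and to
    its real majorant \<open>G\<close>.\<close>
  have regroup: "((\<lambda>mn. \<Sum>k\<in>hermite_range mn. g (hermite_index mn k)) has_sum L) UNIV"
    if "(g has_sum L) UNIV"
    for g :: "('k \<times> 3 \<Rightarrow> nat) \<Rightarrow> 'b::{topological_comm_monoid_add, t3_space}" and L
  proof (rule has_sum_SigmaD)
    show "((\<lambda>x. g (case x of (mn, k) \<Rightarrow> hermite_index mn k)) has_sum L) (Sigma UNIV hermite_range)"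
      unfolding has_sum_reindex_bij_betw[OF bij_betw_hermite_index] by (rule that)
    show "((\<lambda>k. g (case (mn, k) of (mn, k) \<Rightarrow> hermite_index mn k)) has_sum
             (\<Sum>k\<in>hermite_range mn. g (hermite_index mn k))) (hermite_range mn)" for mn
      by (simp add: finite_hermite_range)
  qed
  have "G summable_on UNIV"
    unfolding G_def by (rule summable_on_power_series_majorant) (use q in auto)
  then have H: "H summable_on UNIV"
    unfolding H_def summable_on_def using regroup by blast
  have term_le: "norm (hermite_term c mn p) \<le> H mn" if "p \<in> polydisc q" for mn p
    unfolding term_eq H_def G_def
    by (rule sum_norm_le) (rule norm_power_series_term_le[OF a_le that])
  have "hermite_series_on c f (polydisc q)"
    unfolding hermite_series_on_def
  proof
    show "\<forall>p\<in>polydisc q. (\<lambda>mn. norm (hermite_term c mn p)) summable_on UNIV"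
      using H term_le by (blast intro: summable_on_comparison_test norm_ge_zero)
    show "uniform_limit (polydisc q) (\<lambda>F p. \<Sum>mn\<in>F. hermite_term c mn p) f (finite_subsets_at_top UNIV)"
    proof (rule Weierstrass_m_test_general'[OF term_le _ H])
      fix p :: "complex ^ ('k \<times> 3)" assume "p \<in> polydisc q"
      then have "p \<in> polydisc s" using polydisc_mono[of q s p] q by simp
      from regroup[OF a_sum[OF this]]
      show "((\<lambda>mn. hermite_term c mn p) has_sum f p) UNIV" unfolding term_eq .
    qed
  qed
  moreover have "0 \<in> (polydisc q :: (complex ^ ('k \<times> 3)) set)"
    using q by (simp add: polydisc_def)
  ultimately show ?thesis using open_polydisc by blast
qed

theorem theorem1p6:
  fixes f :: "complex ^ ('k::finite \<times> 3) \<Rightarrow> complex"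
  assumes "sv_analytic_at f 0"
  shows "(\<exists>c U. open U \<and> 0 \<in> U \<and> hermite_series_on c f U) \<longleftrightarrow>
         (\<forall>j::'k. \<forall>\<^sub>F p in nhds 0.
            cpartial (j, 3) f p = cpartial (j, 1) (cpartial (j, 2) f) p)"
  using hermite_series_imp_pde pde_imp_hermite_series[OF assms] by blast

end
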